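(* Let $A\in\mathbb{R}^{m\times n}$ with $m\ge n$ have full rank and nonzero rows, let $b\in\mathbb{R}^m$, and let $q\ge 1$ be an integer. Suppose the probabilities $p_1,\dots,p_m$ and the weights $w_1,\dots,w_m$ are chosen such that, with $P=\mathrm{Diag}(p_1,\dots,p_m)$, $W=\mathrm{Diag}(w_1,\dots,w_m)$ and $D=\mathrm{Diag}(\|A_1\|,\dots,\|A_m\|)$, $$P W D^{-2}=\frac{\alpha}{\|A\|_F^2}\, I$$ for some relaxation parameter $\alpha>0$. Then the error $e^k=x^k-x^\star$ of the iterates of randomized Kaczmarz with averaging (defined in the context) satisfies at each iteration $k$ $$\mathbb{E}\left[\|e^{k+1}\|^2\right]\le \sigma_{\max}\left(\left(I-\alpha\frac{A^\top A}{\|A\|_F^2}\right)^2-\frac{\alpha^2}{q}\left(\frac{A^\top A}{\|A\|_F^2}\right)^2\right)\|e^k\|^2+\frac{\alpha}{q}\,\frac{\|r^k\|_W^2}{\|A\|_F^2},$$ where $r^k=b-Ax^k$ is the residual of the $k$-th iterate, $\|v\|_W^2=\langle v, Wv\rangle$, and the expectation is conditional on $e^k$.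
   Context: $A_i$ denotes the $i$-th row of $A$ (a row vector), $\|\cdot\|$ the Euclidean norm, $\|A\|_F^2=\sum_{i,j}A_{ij}^2$, $I$ an identity matrix of the appropriate size, and $\sigma_{\max}(\cdot)$ the largest singular value. $x^\star=\arg\min_{x\in\mathbb{R}^n}\frac12\|b-Ax\|^2=A^\dagger b$ is the least-squares solution (the system $Ax=b$ need not be consistent). Randomized Kaczmarz with averaging: let $\mathcal{D}$ be the probability distribution on $\{1,\dots,m\}$ with $\mathbb{P}(i=j)=p_j$ for $i\sim\mathcal{D}$, and let $w_1,\dots,w_m\in\mathbb{R}$ be weights. Starting from $x^0\in\mathbb{R}^n$, at each iteration $k=0,1,2,\dots$ one draws a collection (multiset) $\tau_k$ of $q$ indices sampled independently, with replacement, from $\mathcal{D}$ (independently of the previous iterations), and sets $$x^{k+1}=x^k-\frac1q\sum_{i\in\tau_k}w_i\frac{A_ix^k-b_i}{\|A_i\|^2}A_i^\top,$$ where the sum is over the $q$ sampled indices counted with multiplicity. The conditional expectation given $e^k$ is over the random draw of $\tau_k$ only. *)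

theory Defs
  imports "HOL-Probability.Probability"
begin

definition diag_matrix :: "real ^ 'm \<Rightarrow> real ^ 'm ^ 'm" where
  "diag_matrix d = (\<chi> i j. if i = j then d $ i else 0)"

definition frobenius_sq :: "real ^ 'n ^ 'm \<Rightarrow> real" where
  "frobenius_sq A = (\<Sum>i\<in>UNIV. \<Sum>j\<in>UNIV. (A $ i $ j)\<^sup>2)"

text \<open>For matrices with more columns than rows this set may contain an additional \<open>0\<close>
  compared to the usual list of \<open>min m n\<close> singular values, which does not affect the maximum.\<close>

definition singular_values :: "real ^ 'n ^ 'm \<Rightarrow> real set" where
  "singular_values B =
     {s. s \<ge> 0 \<and> (\<exists>v. v \<noteq> 0 \<and> (transpose B ** B) *v v = s\<^sup>2 *\<^sub>R v)}"

definition sigma_max :: "real ^ 'n ^ 'm \<Rightarrow> real" where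
  "sigma_max B = Max (singular_values B)"

definition least_squares_solution :: "real ^ 'n ^ 'm \<Rightarrow> real ^ 'm \<Rightarrow> real ^ 'n" where
  "least_squares_solution A b = (ARG_MIN (\<lambda>x. 1/2 * (norm (b - A *v x))\<^sup>2) x. True)"

definition weighted_norm_sq :: "real ^ 'm ^ 'm \<Rightarrow> real ^ 'm \<Rightarrow> real" where
  "weighted_norm_sq W v = v \<bullet> (W *v v)"

definition kaczmarz_step ::
    "real ^ 'n ^ 'm \<Rightarrow> real ^ 'm \<Rightarrow> real ^ 'm \<Rightarrow> nat \<Rightarrow> 'm multiset \<Rightarrow> real ^ 'n \<Rightarrow> real ^ 'n" where
  "kaczmarz_step A b w q T x =
     x - (1 / real q) *\<^sub>R
       (\<Sum>i\<in>#T. (w $ i * ((row i A \<bullet> x - b $ i) / (norm (row i A))\<^sup>2)) *\<^sub>R row i A)"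

primrec kaczmarz ::
    "real ^ 'n ^ 'm \<Rightarrow> real ^ 'm \<Rightarrow> real ^ 'm \<Rightarrow> nat \<Rightarrow> (nat \<Rightarrow> 'm multiset) \<Rightarrow> real ^ 'n \<Rightarrow>
     nat \<Rightarrow> real ^ 'n" where
  "kaczmarz A b w q \<tau> x0 0 = x0"
| "kaczmarz A b w q \<tau> x0 (Suc k) = kaczmarz_step A b w q (\<tau> k) (kaczmarz A b w q \<tau> x0 k)"

text \<open>\<open>\<xi> k s\<close> is the \<open>s\<close>-th index drawn in iteration \<open>k\<close>, where \<open>s < q\<close>.\<close>

definition iid_samples ::
    "'a measure \<Rightarrow> 'm pmf \<Rightarrow> nat \<Rightarrow> (nat \<Rightarrow> nat \<Rightarrow> 'a \<Rightarrow> 'm) \<Rightarrow> bool" where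
  "iid_samples M p q \<xi> \<longleftrightarrow>
     prob_space.indep_vars M (\<lambda>_. count_space UNIV) (\<lambda>(k, s). \<xi> k s) (UNIV \<times> {..<q}) \<and>
     (\<forall>k. \<forall>s<q. distr M (count_space UNIV) (\<xi> k s) = measure_pmf p)"

definition sample_multiset ::
    "nat \<Rightarrow> (nat \<Rightarrow> nat \<Rightarrow> 'a \<Rightarrow> 'm) \<Rightarrow> 'a \<Rightarrow> nat \<Rightarrow> 'm multiset" where
  "sample_multiset q \<xi> \<omega> k = {# \<xi> k s \<omega>. s \<in># mset_set {..<q} #}"

end

theory Submission
  imports Defs
begin

text \<open>
  The current error \<open>e\<close> is a function of the earlier batches, so conditioning on it amounts to
  averaging over the new batch with \<open>e\<close> held fixed. One sampled correction has mean
  \<open>\<alpha> G e\<close>, by the coupling of probabilities and weights together with the normal equations, and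
  second moment \<open>\<alpha> \<parallel>r\<parallel>\<^sub>W\<^sup>2 / \<parallel>A\<parallel>\<^sub>F\<^sup>2\<close>. Averaging \<open>q\<close> independent copies keeps the mean and divides
  the variance by \<open>q\<close>, so the conditional expectation is exactly
  \<open>e \<bullet> B e + \<alpha> \<parallel>r\<parallel>\<^sub>W\<^sup>2 / (q \<parallel>A\<parallel>\<^sub>F\<^sup>2)\<close> with
  \<open>B = (I - \<alpha> G)\<^sup>2 - (\<alpha>\<^sup>2 / q) G\<^sup>2\<close>, and \<open>e \<bullet> B e \<le> \<sigma>\<^sub>m\<^sub>a\<^sub>x(B) \<parallel>e\<parallel>\<^sup>2\<close>.
\<close>

section \<open>Adjoints, diagonal matrices and the normal equations\<close>

lemma inner_transpose_matrix_vector: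
  fixes B :: "real ^ 'n ^ 'm"
  shows "y \<bullet> (transpose B *v z) = (B *v y) \<bullet> z"
  by (metis dot_lmul_matrix inner_commute transpose_matrix_vector)

lemma diag_matrix_mult: "diag_matrix c ** diag_matrix d = diag_matrix (\<chi> i. c $ i * d $ i)"
  by (simp add: diag_matrix_def matrix_matrix_mult_def vec_eq_iff
      mult_delta_left mult_delta_right)

lemma matrix_inv_diag_matrix:
  assumes "\<And>i. d $ i \<noteq> 0"
  shows "matrix_inv (diag_matrix d) ** diag_matrix d = mat 1"
proof -
  have one: "diag_matrix (\<chi> i. 1) = mat 1"
    by (simp add: diag_matrix_def mat_def vec_eq_iff)
  \<comment> \<open>\<open>matrix_inv\<close> is a choice among two-sided inverses, so one inverse
    has to be exhibited before the chosen one can be used.\<close>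
  have "diag_matrix d ** diag_matrix (\<chi> i. 1 / d $ i) = mat 1 \<and>
        diag_matrix (\<chi> i. 1 / d $ i) ** diag_matrix d = mat 1"
    using assms by (simp add: diag_matrix_mult one)
  then show ?thesis
    unfolding matrix_inv_def by (rule someI2) simp
qed

lemma weighted_norm_sq_diag_matrix:
  "weighted_norm_sq (diag_matrix w) v = (\<Sum>i\<in>UNIV. w $ i * (v $ i)\<^sup>2)"
  by (simp add: weighted_norm_sq_def diag_matrix_def matrix_vector_mult_def inner_vec_def
      mult_delta_left mult_delta_right power2_eq_square mult_ac)

text \<open>Projecting \<open>b\<close> onto the range of \<open>A\<close> exhibits a minimiser, so
  the choice behind \<open>ARG_MIN\<close> is meaningful. Whichever minimiser is chosen, its
  residual is the component of \<open>b\<close> orthogonal to the range, and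
  \<open>transpose A\<close> annihilates that component.\<close>

lemma normal_equations:
  "transpose A *v (b - A *v least_squares_solution A b) = 0"
proof -
  obtain y z where y: "y \<in> span (range ((*v) A))"
    and z: "\<And>w. w \<in> span (range ((*v) A)) \<Longrightarrow> orthogonal z w" and b: "b = y + z"
    using orthogonal_subspace_decomp_exists by metis
  have "span (range ((*v) A)) = range ((*v) A)"
    by (simp add: span_eq_iff linear_subspace_image)
  with y z obtain x1 where x1: "y = A *v x1" and z: "\<And>x. z \<bullet> (A *v x) = 0"
    by (auto simp: orthogonal_def)
  \<comment> \<open>By Pythagoras the objective exceeds its minimum by a square (up to the factor
    1/2), so every minimiser has the same image as \<open>x1\<close>.\<close>
  have pyth: "(norm (b - A *v x))\<^sup>2 = (norm z)\<^sup>2 + (norm (A *v (x1 - x)))\<^sup>2" for x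
  proof -
    have "b - A *v x = z + A *v (x1 - x)"
      by (simp add: b x1 algebra_simps)
    then show ?thesis
      using z[of "x1 - x"]
      by (simp only: power2_norm_eq_inner inner_add_left inner_add_right inner_commute[of "A *v (x1 - x)" z])
  qed
  show ?thesis
    unfolding least_squares_solution_def
  proof (rule arg_minI[where x = x1])
    fix x assume "\<forall>y. True \<longrightarrow> \<not> 1/2 * (norm (b - A *v y))\<^sup>2 < 1/2 * (norm (b - A *v x))\<^sup>2"
    then have "(norm (b - A *v x))\<^sup>2 \<le> (norm (b - A *v x1))\<^sup>2"
      by (auto simp: not_less)
    then have "A *v (x1 - x) = 0"
      unfolding pyth by simp
    then have "b - A *v x = z"
      by (simp add: b x1 algebra_simps)
    then have "u \<bullet> (transpose A *v (b - A *v x)) = 0" for u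
      unfolding inner_transpose_matrix_vector by (simp add: z inner_commute)
    then show "transpose A *v (b - A *v x) = 0"
      by (metis inner_eq_zero_iff)
  qed (simp_all add: pyth)
qed

section \<open>Singular values and the operator norm\<close>

text \<open>Eigenvectors of a symmetric matrix for distinct eigenvalues are orthogonal, and a
  pairwise orthogonal set in finite dimension is finite. This lets \<open>Max\<close> in
  \<open>sigma_max\<close> bound every singular value.\<close>

lemma finite_singular_values: "finite (singular_values B)"
proof -
  let ?C = "transpose B ** B"
  define f where "f s = (SOME v. v \<noteq> 0 \<and> ?C *v v = s\<^sup>2 *\<^sub>R v)" for s
  have f: "f s \<noteq> 0 \<and> ?C *v f s = s\<^sup>2 *\<^sub>R f s" if "s \<in> singular_values B" for s
  proof -
    have "\<exists>v. v \<noteq> 0 \<and> ?C *v v = s\<^sup>2 *\<^sub>R v"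
      using that by (simp add: singular_values_def)
    then show ?thesis
      unfolding f_def by (rule someI_ex)
  qed
  have orth: "f s \<bullet> f t = 0"
    if s: "s \<in> singular_values B" and t: "t \<in> singular_values B" and "s \<noteq> t" for s t
  proof -
    have sym: "x \<bullet> (?C *v y) = (?C *v x) \<bullet> y" for x y
      by (metis inner_transpose_matrix_vector inner_commute matrix_vector_mul_assoc)
    have "t\<^sup>2 * (f s \<bullet> f t) = s\<^sup>2 * (f s \<bullet> f t)"
      using sym[of "f s" "f t"] f[OF s] f[OF t] by simp
    moreover have "s\<^sup>2 \<noteq> t\<^sup>2"
      using s t \<open>s \<noteq> t\<close> by (simp add: singular_values_def)
    ultimately show ?thesis
      by simp
  qed
  \<comment> \<open>A vector shared by two distinct singular values would be orthogonal to itself,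
    but the chosen eigenvectors are nonzero.\<close>
  have "inj_on f (singular_values B)"
    using orth f by (intro inj_onI) (metis inner_eq_zero_iff)
  moreover have "finite (f ` singular_values B)"
    using orth by (intro pairwise_orthogonal_imp_finite) (auto simp: pairwise_def orthogonal_def)
  ultimately show ?thesis
    using finite_imageD by blast
qed

text \<open>By compactness the stretch factor of \<open>B\<close> attains its maximum
  \<open>s\<close> on the unit sphere, and \<open>s\<close> turns out to be a singular
  value.\<close>

lemma norm_matrix_vector_le_sigma_max:
  fixes B :: "real ^ 'n ^ 'm"
  shows "norm (B *v x) \<le> sigma_max B * norm x"
proof -
  let ?S = "sphere (0 :: real ^ 'n) 1"
  have "?S \<noteq> {}" "compact ?S"
    by auto
  moreover have "continuous_on ?S (\<lambda>v. norm (B *v v))"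
    by (intro continuous_intros)
  ultimately obtain v where v: "v \<in> ?S" and max: "\<And>u. u \<in> ?S \<Longrightarrow> norm (B *v u) \<le> norm (B *v v)"
    using continuous_attains_sup by metis
  define s where "s = norm (B *v v)"
  have bound: "norm (B *v u) \<le> s * norm u" for u
  proof (cases "u = 0")
    case False
    then have "norm (B *v (inverse (norm u) *\<^sub>R u)) \<le> s"
      unfolding s_def by (intro max) simp
    then show ?thesis
      using False by (simp add: matrix_vector_mult_scaleR field_simps)
  qed simp
  \<comment> \<open>\<open>Q\<close> is a positive semidefinite quadratic form vanishing at \<open>v\<close>, so its gradient \<open>2 *\<^sub>R g\<close>
    vanishes there, which is the eigenvector equation.\<close>
  define Q where "Q u = s\<^sup>2 * (u \<bullet> u) - (B *v u) \<bullet> (B *v u)" for u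
  define g where "g = s\<^sup>2 *\<^sub>R v - (transpose B ** B) *v v"
  have Q_nonneg: "0 \<le> Q u" for u
    using power_mono[OF bound[of u] norm_ge_zero, of 2]
    by (simp add: Q_def power_mult_distrib power2_norm_eq_inner)
  have "Q v = 0"
    using v by (simp add: Q_def s_def dot_square_norm)
  have inner_g: "u \<bullet> g = s\<^sup>2 * (u \<bullet> v) - (B *v u) \<bullet> (B *v v)" for u
    unfolding g_def inner_diff_right matrix_vector_mul_assoc[symmetric] inner_transpose_matrix_vector
    by simp
  have Q_line: "Q (v - t *\<^sub>R g) = t\<^sup>2 * Q g - 2 * t * (g \<bullet> g)" for t
  proof -
    have "Q (v - t *\<^sub>R g) =
        Q v - 2 * t * (s\<^sup>2 * (g \<bullet> v) - (B *v g) \<bullet> (B *v v)) + t\<^sup>2 * Q g"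
      unfolding Q_def
      by (simp add: matrix_vector_mult_diff_distrib matrix_vector_mult_scaleR inner_diff
          inner_commute[of v g] inner_commute[of "B *v v" "B *v g"] algebra_simps power2_eq_square)
    with \<open>Q v = 0\<close> inner_g[of g] show ?thesis
      by simp
  qed
  have "g = 0"
  proof (rule ccontr)
    assume "g \<noteq> 0"
    then have g: "g \<bullet> g > 0"
      by simp
    \<comment> \<open>The summand 1 keeps the denominator positive when \<open>Q g\<close> vanishes.
      With this step size the linear term of \<open>Q_line\<close> outweighs the quadratic
      one.\<close>
    define t where "t = (g \<bullet> g) / (Q g + 1)"
    have "t > 0" and "t * (Q g + 1) = g \<bullet> g"
      using g Q_nonneg[of g] by (simp_all add: t_def)
    then have "t * Q g < 2 * (g \<bullet> g)"
      using g by (simp add: distrib_left del: inner_gt_zero_iff)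
    then have "Q (v - t *\<^sub>R g) < 0"
      unfolding Q_line using \<open>t > 0\<close> mult_strict_left_mono[of "t * Q g" "2 * (g \<bullet> g)" t]
      by (simp add: power2_eq_square algebra_simps)
    with Q_nonneg show False
      by (simp add: not_less[symmetric])
  qed
  then have "s \<in> singular_values B"
    using v by (auto simp: singular_values_def g_def s_def intro!: exI[of _ v])
  then have "s \<le> sigma_max B"
    unfolding sigma_max_def by (intro Max_ge finite_singular_values)
  then show ?thesis
    using bound[of x] mult_right_mono[of s "sigma_max B" "norm x"] by simp
qed

text \<open>The matrix in the theorem need not be positive semidefinite: for \<open>q = 1\<close> it
  is \<open>I - 2 \<alpha> G\<close>. The form is therefore bounded through the norm of
  \<open>B *v x\<close> rather than through a largest eigenvalue.\<close>

lemma inner_matrix_vector_le_sigma_max: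
  fixes B :: "real ^ 'n ^ 'n"
  shows "x \<bullet> (B *v x) \<le> sigma_max B * (norm x)\<^sup>2"
proof -
  have "x \<bullet> (B *v x) \<le> norm x * norm (B *v x)"
    by (rule norm_cauchy_schwarz)
  also have "\<dots> \<le> norm x * (sigma_max B * norm x)"
    by (intro mult_left_mono norm_matrix_vector_le_sigma_max) simp
  finally show ?thesis
    by (simp add: power2_eq_square mult_ac)
qed

section \<open>Conditional expectation given an independent variable\<close>

text \<open>The two variables of \<open>indep_var\<close> range over one type; the map \<open>f\<close> lets the
  conditioning variable \<open>f (V \<omega>)\<close> have a type different from that of \<open>Y\<close>.\<close>

lemma (in prob_space) real_cond_exp_indep_var:
  assumes ind: "indep_var L V C Y"
    and f[measurable]: "f \<in> measurable L N"
    and meas[measurable]: "case_prod \<Phi> \<in> borel_measurable (N \<Otimes>\<^sub>M C)"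
    and int: "integrable M (\<lambda>\<omega>. \<Phi> (f (V \<omega>)) (Y \<omega>))"
  shows "AE \<omega> in M. real_cond_exp M (vimage_algebra (space M) (\<lambda>\<omega>. f (V \<omega>)) N)
             (\<lambda>\<omega>. \<Phi> (f (V \<omega>)) (Y \<omega>)) \<omega>
           = expectation (\<lambda>\<omega>'. \<Phi> (f (V \<omega>)) (Y \<omega>'))"
proof -
  define X where "X = (\<lambda>\<omega>. f (V \<omega>))"
  have int: "integrable M (\<lambda>\<omega>. \<Phi> (X \<omega>) (Y \<omega>))"
    using int by (simp add: X_def)
  have V[measurable]: "V \<in> measurable M L" and Y[measurable]: "Y \<in> measurable M C"
    using ind by (auto dest: indep_var_rv1 indep_var_rv2)
  have X[measurable]: "X \<in> measurable M N"
    by (simp add: X_def)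
  have XN: "X \<in> space M \<rightarrow> space N"
    using X by (auto simp: measurable_def)
  let ?F = "vimage_algebra (space M) X N"
  have sub: "subalgebra M ?F"
    by (simp add: subalgebra_def sets_image_in_sets)
  interpret F: finite_measure_subalgebra M ?F
    using sub by unfold_locales
  interpret DX: prob_space "distr M N X" by (rule prob_space_distr) simp
  interpret DY: prob_space "distr M C Y" by (rule prob_space_distr) simp
  interpret XY: pair_prob_space "distr M N X" "distr M C Y" ..
  \<comment> \<open>Independence gives the product law for \<open>V\<close> and \<open>Y\<close>;
    pushing the first factor forward along \<open>f\<close> transfers it to \<open>X\<close> and
    \<open>Y\<close>.\<close>
  have joint: "distr M N X \<Otimes>\<^sub>M distr M C Y = distr M (N \<Otimes>\<^sub>M C) (\<lambda>\<omega>. (X \<omega>, Y \<omega>))"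
  proof -
    have "distr M N X \<Otimes>\<^sub>M distr M C Y = distr (distr M L V) N f \<Otimes>\<^sub>M distr (distr M C Y) C (\<lambda>y. y)"
      by (simp add: distr_distr comp_def X_def)
    also have "\<dots> = distr (distr M L V \<Otimes>\<^sub>M distr M C Y) (N \<Otimes>\<^sub>M C) (\<lambda>(v, y). (f v, y))"
      by (rule pair_measure_distr)
         (simp_all add: distr_distr comp_def DY.sigma_finite_measure_axioms)
    also have "distr M L V \<Otimes>\<^sub>M distr M C Y = distr M (L \<Otimes>\<^sub>M C) (\<lambda>\<omega>. (V \<omega>, Y \<omega>))"
      using ind by (simp add: indep_var_distribution_eq)
    finally show ?thesis
      by (simp add: distr_distr comp_def X_def)
  qed
  \<comment> \<open>The candidate for the conditional expectation: the first argument is frozen and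
    the second is integrated out.\<close>
  define h where "h x = (\<integral>y. \<Phi> x y \<partial>distr M C Y)" for x
  have h: "h x = expectation (\<lambda>\<omega>'. \<Phi> x (Y \<omega>'))" if "x \<in> space N" for x
  proof -
    have "(\<lambda>y. \<Phi> x y) \<in> borel_measurable C"
      using measurable_compose[OF measurable_Pair1'[OF that] meas] by simp
    then show ?thesis
      unfolding h_def by (intro integral_distr) simp_all
  qed
  have h_meas: "h \<in> borel_measurable N"
  proof -
    have "(\<lambda>x. \<integral>y. \<Phi> x y \<partial>distr M C Y) \<in> borel_measurable N"
      by (rule DY.borel_measurable_lebesgue_integral)
         (simp add: meas cong: measurable_cong_sets)
    then show ?thesis by (simp add: h_def[abs_def])
  qed
  note h_meas[measurable]
  have int_XY: "integrable (distr M N X \<Otimes>\<^sub>M distr M C Y) (case_prod \<Phi>)"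
    unfolding joint using int by (simp add: integrable_distr_eq)
  have "AE \<omega> in M. real_cond_exp M ?F (\<lambda>\<omega>. \<Phi> (X \<omega>) (Y \<omega>)) \<omega> = h (X \<omega>)"
  proof (rule F.real_cond_exp_charact)
    show "integrable M (\<lambda>\<omega>. h (X \<omega>))"
      using XY.integrable_fst'[OF int_XY] by (simp add: integrable_distr_eq h_def[symmetric])
    show "(\<lambda>\<omega>. h (X \<omega>)) \<in> borel_measurable ?F"
      using measurable_vimage_algebra1[OF XN] by simp
    fix E assume "E \<in> sets ?F"
    then obtain S where S[measurable]: "S \<in> sets N" and E: "E = X -` S \<inter> space M"
      unfolding sets_vimage_algebra2[OF XN] by blast
    \<comment> \<open>Events of the conditioning algebra are preimages under \<open>X\<close>, so
      restricting to one multiplies the integrand by an indicator in the first coordinate, which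
      Fubini moves out of the inner integral.\<close>
    define \<Psi> where "\<Psi> = (\<lambda>z. indicator S (fst z) * case_prod \<Phi> z :: real)"
    have \<Psi>_meas[measurable]: "\<Psi> \<in> borel_measurable (N \<Otimes>\<^sub>M C)"
      unfolding \<Psi>_def by measurable
    have int_\<Psi>: "integrable (distr M N X \<Otimes>\<^sub>M distr M C Y) \<Psi>"
    proof (rule Bochner_Integration.integrable_bound[OF int_XY])
      show "\<Psi> \<in> borel_measurable (distr M N X \<Otimes>\<^sub>M distr M C Y)"
        by (simp cong: measurable_cong_sets)
    qed (auto simp: \<Psi>_def indicator_def)
    have "(\<integral>\<omega>\<in>E. \<Phi> (X \<omega>) (Y \<omega>) \<partial>M) = (\<integral>\<omega>. \<Psi> (X \<omega>, Y \<omega>) \<partial>M)"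
      unfolding set_lebesgue_integral_def
      by (intro Bochner_Integration.integral_cong) (auto simp: E \<Psi>_def indicator_def)
    also have "\<dots> = integral\<^sup>L (distr M N X \<Otimes>\<^sub>M distr M C Y) \<Psi>"
      unfolding joint by (simp add: integral_distr)
    also have "\<dots> = (\<integral>x. \<integral>y. \<Psi> (x, y) \<partial>distr M C Y \<partial>distr M N X)"
      by (rule XY.integral_fst'[OF int_\<Psi>, symmetric])
    also have "\<dots> = (\<integral>x. indicator S x * h x \<partial>distr M N X)"
      by (simp add: \<Psi>_def h_def)
    also have "\<dots> = (\<integral>\<omega>. indicator S (X \<omega>) * h (X \<omega>) \<partial>M)"
      by (simp add: integral_distr)
    also have "\<dots> = (\<integral>\<omega>\<in>E. h (X \<omega>) \<partial>M)"
      unfolding set_lebesgue_integral_def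
      by (intro Bochner_Integration.integral_cong) (auto simp: E indicator_def)
    finally show "(\<integral>\<omega>\<in>E. \<Phi> (X \<omega>) (Y \<omega>) \<partial>M) = (\<integral>\<omega>\<in>E. h (X \<omega>) \<partial>M)" .
  qed (fact int)
  then have "AE \<omega> in M. real_cond_exp M ?F (\<lambda>\<omega>. \<Phi> (X \<omega>) (Y \<omega>)) \<omega>
      = expectation (\<lambda>\<omega>'. \<Phi> (X \<omega>) (Y \<omega>'))"
    by (rule AE_mp) (use XN h in \<open>auto intro!: AE_I2\<close>)
  then show ?thesis
    by (simp only: X_def)
qed

section \<open>Second moment of an average of independent draws\<close>

text \<open>In the expanded square, distinct draws contribute \<open>\<mu> \<bullet> \<mu>\<close>
  by independence, and equal ones the second moment of \<open>h\<close>. The average thus keeps the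
  mean, while the variance is divided by \<open>card J\<close>.\<close>

lemma (in prob_space) expectation_norm_sq_sub_average:
  fixes h :: "'m::finite \<Rightarrow> 'v::euclidean_space" and p :: "'m pmf"
  assumes ind: "indep_vars (\<lambda>_. count_space UNIV) Z J"
    and dist: "\<And>j. j \<in> J \<Longrightarrow> distr M (count_space UNIV) (Z j) = measure_pmf p"
    and J: "finite J" "J \<noteq> {}"
  defines "\<mu> \<equiv> (\<Sum>i\<in>UNIV. pmf p i *\<^sub>R h i)"
  shows "expectation (\<lambda>\<omega>. (norm (c - (1 / real (card J)) *\<^sub>R (\<Sum>j\<in>J. h (Z j \<omega>))))\<^sup>2)
    = (norm (c - \<mu>))\<^sup>2 - (norm \<mu>)\<^sup>2 / real (card J)
      + (\<Sum>i\<in>UNIV. pmf p i * (norm (h i))\<^sup>2) / real (card J)"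
proof -
  define n where "n = real (card J)"
  have n: "n > 0"
    using J by (simp add: n_def card_gt_0_iff)
  have Z[measurable]: "Z j \<in> measurable M (count_space UNIV)" if "j \<in> J" for j
    using ind that by (simp add: indep_vars_def)
  have int_fun: "integrable M (\<lambda>\<omega>. f (Z j \<omega>))" if "j \<in> J" for f :: "'m \<Rightarrow> real" and j
  proof -
    have "integrable (distr M (count_space UNIV) (Z j)) f"
      unfolding dist[OF that] by (rule integrable_measure_pmf_finite) simp
    then show ?thesis
      by (subst (asm) integrable_distr_eq) (use that in simp_all)
  qed
  have exp_fun: "expectation (\<lambda>\<omega>. f (Z j \<omega>)) = (\<Sum>i\<in>UNIV. pmf p i * f i)"
    if "j \<in> J" for f :: "'m \<Rightarrow> real" and j
  proof -
    have "expectation (\<lambda>\<omega>. f (Z j \<omega>)) = integral\<^sup>L (distr M (count_space UNIV) (Z j)) f"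
      by (rule integral_distr[symmetric]) (use that in simp_all)
    also have "\<dots> = (\<Sum>i\<in>UNIV. f i * pmf p i)"
      unfolding dist[OF that] by (rule integral_measure_pmf_real) simp_all
    finally show ?thesis
      by (simp add: mult.commute)
  qed
  have exp_inner: "expectation (\<lambda>\<omega>. h (Z j \<omega>) \<bullet> u) = \<mu> \<bullet> u" if "j \<in> J" for j u
    using exp_fun[OF that, of "\<lambda>i. h i \<bullet> u"] by (simp add: \<mu>_def inner_sum_left)
  have pair: "integrable M (\<lambda>\<omega>. h (Z i \<omega>) \<bullet> h (Z j \<omega>)) \<and>
      expectation (\<lambda>\<omega>. h (Z i \<omega>) \<bullet> h (Z j \<omega>)) = \<mu> \<bullet> \<mu>"
    if ij: "i \<in> J" "j \<in> J" "i \<noteq> j" for i j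
  proof -
    \<comment> \<open>Each coordinate \<open>u\<close> gives a pair of independent real variables;
      the product rule is applied to these and summed over \<open>Basis\<close>.\<close>
    have "indep_var borel (\<lambda>\<omega>. h (Z i \<omega>) \<bullet> u) borel (\<lambda>\<omega>. h (Z j \<omega>) \<bullet> u)" for u
    proof -
      have "indep_var
          borel ((\<lambda>z. h (z i) \<bullet> u) \<circ> (\<lambda>\<omega>. restrict (\<lambda>l. Z l \<omega>) {i}))
          borel ((\<lambda>z. h (z j) \<bullet> u) \<circ> (\<lambda>\<omega>. restrict (\<lambda>l. Z l \<omega>) {j}))"
        by (rule indep_var_compose[OF indep_var_restrict[OF ind]])
           (use ij in \<open>auto intro!: measurable_compose[OF measurable_component_singleton[of _ _ "\<lambda>_. count_space UNIV"]]\<close>)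
      then show ?thesis
        by (simp add: comp_def)
    qed
    note prod = indep_var_lebesgue_integral[OF this int_fun[OF ij(1)] int_fun[OF ij(2)]]
      and prod_int = indep_var_integrable[OF this int_fun[OF ij(1)] int_fun[OF ij(2)]]
    have "h (Z i \<omega>) \<bullet> h (Z j \<omega>) = (\<Sum>u\<in>Basis. (h (Z i \<omega>) \<bullet> u) * (h (Z j \<omega>) \<bullet> u))" for \<omega>
      by (rule euclidean_inner)
    moreover have "\<mu> \<bullet> \<mu> = (\<Sum>u\<in>Basis. (\<mu> \<bullet> u) * (\<mu> \<bullet> u))"
      by (rule euclidean_inner)
    ultimately show ?thesis
      using prod prod_int by (simp add: exp_inner ij)
  qed
  \<comment> \<open>Writing the diagonal case as a correction to
    \<open>\<mu> \<bullet> \<mu>\<close> lets the double sum collapse to a constant part plus one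
    correction per draw.\<close>
  have second: "integrable M (\<lambda>\<omega>. h (Z i \<omega>) \<bullet> h (Z j \<omega>)) \<and>
      expectation (\<lambda>\<omega>. h (Z i \<omega>) \<bullet> h (Z j \<omega>)) =
        \<mu> \<bullet> \<mu> + (if i = j then (\<Sum>i\<in>UNIV. pmf p i * (norm (h i))\<^sup>2) - \<mu> \<bullet> \<mu> else 0)"
    if "i \<in> J" "j \<in> J" for i j
  proof (cases "i = j")
    case True
    then show ?thesis
      using that int_fun[of j "\<lambda>i. h i \<bullet> h i"] exp_fun[of j "\<lambda>i. h i \<bullet> h i"]
      by (simp add: power2_norm_eq_inner)
  qed (use pair[OF that] in simp)
  have int1: "integrable M (\<lambda>\<omega>. \<Sum>j\<in>J. h (Z j \<omega>) \<bullet> c)"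
    by (intro Bochner_Integration.integrable_sum int_fun[of _ "\<lambda>i. h i \<bullet> c"])
  have exp1: "expectation (\<lambda>\<omega>. \<Sum>j\<in>J. h (Z j \<omega>) \<bullet> c) = (\<Sum>j\<in>J. \<mu> \<bullet> c)"
    by (subst Bochner_Integration.integral_sum)
       (auto simp: exp_inner intro: int_fun[of _ "\<lambda>i. h i \<bullet> c"])
  have int2: "integrable M (\<lambda>\<omega>. \<Sum>i\<in>J. \<Sum>j\<in>J. h (Z i \<omega>) \<bullet> h (Z j \<omega>))"
    using second by (intro Bochner_Integration.integrable_sum) blast
  have exp2: "expectation (\<lambda>\<omega>. \<Sum>i\<in>J. \<Sum>j\<in>J. h (Z i \<omega>) \<bullet> h (Z j \<omega>)) =
      (\<Sum>i\<in>J. \<Sum>j\<in>J. \<mu> \<bullet> \<mu>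
          + (if i = j then (\<Sum>i\<in>UNIV. pmf p i * (norm (h i))\<^sup>2) - \<mu> \<bullet> \<mu> else 0))"
    using second by (simp add: Bochner_Integration.integral_sum)
  have "(norm (c - (1 / n) *\<^sub>R (\<Sum>j\<in>J. h (Z j \<omega>))))\<^sup>2 =
      c \<bullet> c - (2 / n) * (\<Sum>j\<in>J. h (Z j \<omega>) \<bullet> c)
      + (1 / n\<^sup>2) * (\<Sum>i\<in>J. \<Sum>j\<in>J. h (Z i \<omega>) \<bullet> h (Z j \<omega>))" for \<omega>
    unfolding power2_norm_eq_inner inner_sum_left[symmetric] inner_sum_right[symmetric]
    by (simp add: inner_diff inner_commute[of c "sum _ _"] power2_eq_square algebra_simps diff_divide_distrib)
  then have "expectation (\<lambda>\<omega>. (norm (c - (1 / n) *\<^sub>R (\<Sum>j\<in>J. h (Z j \<omega>))))\<^sup>2) =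
      c \<bullet> c - (2 / n) * (\<Sum>j\<in>J. \<mu> \<bullet> c)
      + (1 / n\<^sup>2) * (\<Sum>i\<in>J. \<Sum>j\<in>J. \<mu> \<bullet> \<mu>
          + (if i = j then (\<Sum>i\<in>UNIV. pmf p i * (norm (h i))\<^sup>2) - \<mu> \<bullet> \<mu> else 0))"
    using int1 int2 by (simp add: exp1 exp2 prob_space)
  also have "\<dots> = c \<bullet> c - (2 / n) * (n * (\<mu> \<bullet> c)) + (1 / n\<^sup>2) * (n * (n * (\<mu> \<bullet> \<mu>)
      + ((\<Sum>i\<in>UNIV. pmf p i * (norm (h i))\<^sup>2) - \<mu> \<bullet> \<mu>)))"
    using J by (simp add: sum.distrib n_def sum.delta algebra_simps)
  also have "\<dots> = (norm (c - \<mu>))\<^sup>2 - (norm \<mu>)\<^sup>2 / n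
      + (\<Sum>i\<in>UNIV. pmf p i * (norm (h i))\<^sup>2) / n"
    unfolding power2_norm_eq_inner[of "c - \<mu>"] power2_norm_eq_inner[of \<mu>] using n
    by (simp add: inner_diff inner_commute[of c \<mu>] power2_eq_square field_simps)
  finally show ?thesis
    by (simp add: n_def)
qed

section \<open>The iterates as functions of the sample path\<close>

definition row_correction ::
    "real ^ 'n ^ 'm \<Rightarrow> real ^ 'm \<Rightarrow> real ^ 'm \<Rightarrow> 'm \<Rightarrow> real ^ 'n \<Rightarrow> real ^ 'n" where
  "row_correction A b w i x =
     (w $ i * ((row i A \<bullet> x - b $ i) / (norm (row i A))\<^sup>2)) *\<^sub>R row i A"

text \<open>Replaces the multiset sum by a sum over draw positions, where independence of the single
  draws can be applied.\<close>

lemma kaczmarz_step_sample_multiset: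
  "kaczmarz_step A b w q (sample_multiset q \<xi> \<omega> k) x =
     x - (1 / real q) *\<^sub>R (\<Sum>s<q. row_correction A b w (\<xi> k s \<omega>) x)"
  by (simp add: kaczmarz_step_def sample_multiset_def row_correction_def sum_unfold_sum_mset
      multiset.map_comp comp_def)

lemma measurable_row_correction:
  assumes "I \<in> measurable N (count_space UNIV)" and "X \<in> borel_measurable N"
  shows "(\<lambda>z. row_correction A b w (I z) (X z)) \<in> borel_measurable N"
proof (rule measurable_compose_countable'[OF _ assms(1)])
  show "(\<lambda>z. row_correction A b w i (X z)) \<in> borel_measurable N" for i
    unfolding row_correction_def using assms(2) by measurable
qed (simp add: countable_finite)

text \<open>Taking \<open>\<lambda>j s z. z (j, s)\<close> as the sampling process turns the sample path \<open>z\<close> itself into the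
  outcome, which exhibits the iterates as functions on the product space of the first batches.\<close>

lemma measurable_kaczmarz:
  assumes "k \<le> K"
  shows "(\<lambda>z. kaczmarz A b w q (sample_multiset q (\<lambda>j s z. z (j, s)) z) x0 k)
    \<in> borel_measurable (PiM ({..<K} \<times> {..<q}) (\<lambda>_. count_space UNIV))"
  using assms
proof (induction k)
  case (Suc k)
  then have "(\<lambda>z. row_correction A b w (z (k, s))
        (kaczmarz A b w q (sample_multiset q (\<lambda>j s z. z (j, s)) z) x0 k))
      \<in> borel_measurable (PiM ({..<K} \<times> {..<q}) (\<lambda>_. count_space UNIV))" if "s < q" for s
    using that by (intro measurable_row_correction measurable_component_singleton) auto
  with Suc show ?case
    by (simp add: kaczmarz_step_sample_multiset)
qed simp

text \<open>Iterate \<open>k\<close> reads only batches before \<open>k\<close>. It therefore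
  depends on past draws alone, which are independent of the next batch.\<close>

lemma kaczmarz_restrict:
  assumes "k \<le> K"
  shows "kaczmarz A b w q (sample_multiset q \<xi> \<omega>) x0 k =
    kaczmarz A b w q (sample_multiset q (\<lambda>j s z. z (j, s))
      (restrict (\<lambda>i. (case i of (j, s) \<Rightarrow> \<xi> j s) \<omega>) ({..<K} \<times> {..<q}))) x0 k"
  using assms by (induction k) (simp_all add: kaczmarz_step_sample_multiset)

text \<open>Only finitely many index paths of length \<open>k\<close> exist. The resulting
  boundedness of the errors yields integrability.\<close>

lemma finite_range_kaczmarz:
  fixes A :: "real ^ 'n ^ 'm"
  shows "finite (range (\<lambda>\<omega>. kaczmarz A b w q (sample_multiset q \<xi> \<omega>) x0 k))"
proof (rule finite_subset)
  show "range (\<lambda>\<omega>. kaczmarz A b w q (sample_multiset q \<xi> \<omega>) x0 k) \<subseteq>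
      (\<lambda>z. kaczmarz A b w q (sample_multiset q (\<lambda>j s z. z (j, s)) z) x0 k) `
        (({..<k} \<times> {..<q}) \<rightarrow>\<^sub>E (UNIV :: 'm set))"
    by (intro image_subsetI, subst kaczmarz_restrict[OF order_refl]) (auto simp del: restrict_apply)
qed (simp add: finite_PiE)

section \<open>Row expansions and quadratic forms\<close>

lemma transpose_mult_row_sum:
  "transpose A *v v = (\<Sum>i\<in>UNIV. v $ i *\<^sub>R row i A)"
  by (simp add: vec_eq_iff matrix_vector_mult_def transpose_def row_def mult.commute)

lemma inner_row: "row i A \<bullet> x = (A *v x) $ i"
  by (simp add: matrix_vector_mult_def row_def inner_vec_def)

lemma inner_symmetric_mult_self:
  fixes S :: "real ^ 'n ^ 'n"
  assumes "transpose S = S"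
  shows "x \<bullet> ((S ** S) *v x) = (norm (S *v x))\<^sup>2"
  by (metis assms inner_transpose_matrix_vector matrix_vector_mul_assoc power2_norm_eq_inner)

section \<open>The one-step conditional error bound\<close>

theorem theorem1:
  fixes A :: "real ^ 'n ^ 'm" and b w :: "real ^ 'm" and x0 :: "real ^ 'n"
    and p :: "'m pmf" and q k :: nat and \<alpha> :: real
    and M :: "'a measure" and \<xi> :: "nat \<Rightarrow> nat \<Rightarrow> 'a \<Rightarrow> 'm"
    and P W D :: "real ^ 'm ^ 'm" and G :: "real ^ 'n ^ 'n"
    and x e :: "nat \<Rightarrow> 'a \<Rightarrow> real ^ 'n" and r :: "nat \<Rightarrow> 'a \<Rightarrow> real ^ 'm"
  defines "P \<equiv> diag_matrix (\<chi> i. pmf p i)"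
    and "W \<equiv> diag_matrix w"
    and "D \<equiv> diag_matrix (\<chi> i. norm (row i A))"
    and "G \<equiv> (1 / frobenius_sq A) *\<^sub>R (transpose A ** A)"
    and "x \<equiv> (\<lambda>j \<omega>. kaczmarz A b w q (sample_multiset q \<xi> \<omega>) x0 j)"
    and "e \<equiv> (\<lambda>j \<omega>. x j \<omega> - least_squares_solution A b)"
    and "r \<equiv> (\<lambda>j \<omega>. b - A *v x j \<omega>)"
  assumes "CARD('n) \<le> CARD('m)"
    and "rank A = min (CARD('m)) (CARD('n))"
    and "\<And>i. row i A \<noteq> 0"
    and "q \<ge> 1"
    and "\<alpha> > 0"
    and "P ** W ** (matrix_inv D ** matrix_inv D) = (\<alpha> / frobenius_sq A) *\<^sub>R mat 1"
    and "prob_space M"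
    and "iid_samples M p q \<xi>"
  shows "AE \<omega> in M.
    real_cond_exp M (vimage_algebra (space M) (e k) borel) (\<lambda>\<omega>'. (norm (e (Suc k) \<omega>'))\<^sup>2) \<omega>
      \<le> sigma_max ((mat 1 - \<alpha> *\<^sub>R G) ** (mat 1 - \<alpha> *\<^sub>R G) - (\<alpha>\<^sup>2 / real q) *\<^sub>R (G ** G))
            * (norm (e k \<omega>))\<^sup>2
          + \<alpha> / real q * (weighted_norm_sq W (r k \<omega>) / frobenius_sq A)"
proof -
  interpret prob_space M by fact
  define F where "F = frobenius_sq A"
  define xs where "xs = least_squares_solution A b"
  \<comment> \<open>Pairs of iteration and position index all draws, so the past
    \<open>{..<k} \<times> {..<q}\<close> and the new batch \<open>J\<close> are disjoint parts of
    one independent family.\<close>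
  define J where "J = {k} \<times> {..<q}"
  define Z where "Z = (\<lambda>(j, s). \<xi> j s)"
  define X where "X = (\<lambda>\<omega>. restrict (\<lambda>i. Z i \<omega>) ({..<k} \<times> {..<q}))"
  define Y where "Y = (\<lambda>\<omega>. restrict (\<lambda>i. Z i \<omega>) J)"
  \<comment> \<open>The next squared error as a function of the current error \<open>c\<close> and
    the fresh batch \<open>y\<close>; \<open>c + xs\<close> recovers the iterate.\<close>
  define \<Phi> where "\<Phi> c y = (norm (c - (1 / real q) *\<^sub>R
      (\<Sum>j\<in>J. row_correction A b w (y j) (c + xs))))\<^sup>2" for c and y :: "nat \<times> nat \<Rightarrow> 'm"
  let ?N = "\<lambda>I. PiM I (\<lambda>_ :: nat \<times> nat. count_space (UNIV :: 'm set))"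

  have ind: "indep_vars (\<lambda>_. count_space UNIV) Z (UNIV \<times> {..<q})"
    and dist: "\<And>j s. s < q \<Longrightarrow> distr M (count_space UNIV) (\<xi> j s) = measure_pmf p"
    using assms(15) by (auto simp: iid_samples_def Z_def)
  have row: "norm (row i A) > 0" for i
    using assms(10) by simp
  have "F > 0"
  proof -
    obtain i :: 'm where True by simp
    have "(\<Sum>j\<in>UNIV. (A $ i $ j)\<^sup>2) = row i A \<bullet> row i A"
      by (simp add: row_def inner_vec_def power2_eq_square)
    then have "0 < (\<Sum>j\<in>UNIV. (A $ i $ j)\<^sup>2)"
      using assms(10) by simp
    also have "\<dots> \<le> F"
      unfolding F_def frobenius_sq_def
      by (rule member_le_sum[where f = "\<lambda>i. \<Sum>j\<in>UNIV. (A $ i $ j)\<^sup>2"]) (auto intro: sum_nonneg)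
    finally show ?thesis .
  qed
  \<comment> \<open>Multiplying the coupling hypothesis by \<open>D ** D\<close> cancels the
    inverses; the diagonal entries then give the claim.\<close>
  have pw: "pmf p i * w $ i = \<alpha> / F * (norm (row i A))\<^sup>2" for i
  proof -
    have D: "matrix_inv D ** D = mat 1"
      unfolding D_def using row by (intro matrix_inv_diag_matrix) (simp add: less_imp_neq[symmetric])
    have "P ** W ** (matrix_inv D ** matrix_inv D) ** (D ** D)
        = P ** W ** (matrix_inv D ** (matrix_inv D ** D) ** D)"
      by (simp only: matrix_mul_assoc)
    also have "\<dots> = P ** W"
      by (simp add: D)
    finally have "P ** W = ((\<alpha> / F) *\<^sub>R mat 1) ** (D ** D)"
      using assms(13) by (simp add: F_def)
    then have "(P ** W) $ i $ i = (\<alpha> / F) * (D ** D) $ i $ i"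
      by (simp add: scalar_matrix_assoc[symmetric])
    then show ?thesis
      by (simp add: P_def W_def D_def diag_matrix_mult) (simp add: diag_matrix_def power2_eq_square)
  qed

  have e_Suc: "(norm (e (Suc k) \<omega>))\<^sup>2 = \<Phi> (e k \<omega>) (Y \<omega>)" for \<omega>
  proof -
    have "(\<Sum>j\<in>J. row_correction A b w (Y \<omega> j) (x k \<omega>)) =
        (\<Sum>s<q. row_correction A b w (\<xi> k s \<omega>) (x k \<omega>))"
      by (rule sum.reindex_bij_witness[of _ "\<lambda>s. (k, s)" snd]) (auto simp: J_def Y_def Z_def)
    then show ?thesis
      by (simp add: \<Phi>_def e_def xs_def) (simp add: x_def kaczmarz_step_sample_multiset algebra_simps)
  qed
  define f where "f = (\<lambda>z. kaczmarz A b w q (sample_multiset q (\<lambda>j s z. z (j, s)) z) x0 k - xs)"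
  have e_X: "e k = (\<lambda>\<omega>. f (X \<omega>))"
    unfolding e_def x_def xs_def X_def Z_def f_def
    by (rule ext, subst kaczmarz_restrict[OF order_refl]) simp
  have f[measurable]: "f \<in> borel_measurable (?N ({..<k} \<times> {..<q}))"
    unfolding f_def by (intro borel_measurable_diff measurable_kaczmarz) simp_all
  have indep: "indep_var (?N ({..<k} \<times> {..<q})) X (?N J) Y"
    unfolding X_def Y_def by (rule indep_var_restrict[OF ind]) (auto simp: J_def)
  have [measurable]: "e k \<in> borel_measurable M" "Y \<in> measurable M (?N J)"
    using measurable_compose[OF indep_var_rv1[OF indep] f] indep_var_rv2[OF indep]
    by (simp_all add: e_X)
  have \<Phi>_meas: "case_prod \<Phi> \<in> borel_measurable (borel \<Otimes>\<^sub>M ?N J)"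
  proof -
    have "(\<lambda>z. row_correction A b w (snd z j) (fst z + xs)) \<in> borel_measurable (borel \<Otimes>\<^sub>M ?N J)"
      if "j \<in> J" for j
      using that
      by (intro measurable_row_correction measurable_compose[OF measurable_snd measurable_component_singleton])
         simp_all
    then show ?thesis
      unfolding \<Phi>_def by (simp add: case_prod_beta)
  qed
  have \<Phi>_int: "integrable M (\<lambda>\<omega>. \<Phi> (e k \<omega>) (Y \<omega>))"
  proof -
    have "finite ((\<lambda>y. (norm (y - xs))\<^sup>2) ` range (\<lambda>\<omega>. x (Suc k) \<omega>))"
      unfolding x_def by (intro finite_imageI finite_range_kaczmarz)
    then obtain C where "\<forall>u \<in> (\<lambda>y. (norm (y - xs))\<^sup>2) ` range (\<lambda>\<omega>. x (Suc k) \<omega>). norm u \<le> C"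
      using finite_imp_bounded bounded_iff by metis
    then have C: "norm (\<Phi> (e k \<omega>) (Y \<omega>)) \<le> C" for \<omega>
      unfolding e_Suc[symmetric] by (simp add: e_def xs_def)
    have "(\<lambda>\<omega>. \<Phi> (e k \<omega>) (Y \<omega>)) \<in> borel_measurable M"
      using measurable_compose[OF measurable_Pair \<Phi>_meas, of "e k" M Y] by simp
    then show ?thesis
      using C by (intro integrable_const_bound[where B = C]) auto
  qed

  have expect: "expectation (\<lambda>\<omega>. \<Phi> c (Y \<omega>)) \<le>
      sigma_max ((mat 1 - \<alpha> *\<^sub>R G) ** (mat 1 - \<alpha> *\<^sub>R G) - (\<alpha>\<^sup>2 / real q) *\<^sub>R (G ** G)) * (norm c)\<^sup>2
        + \<alpha> / real q * (weighted_norm_sq W (b - A *v (c + xs)) / F)" for c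
  proof -
    let ?h = "\<lambda>i. row_correction A b w i (c + xs)"
    let ?B = "(mat 1 - \<alpha> *\<^sub>R G) ** (mat 1 - \<alpha> *\<^sub>R G) - (\<alpha>\<^sup>2 / real q) *\<^sub>R (G ** G)"
    \<comment> \<open>This is the residual with opposite sign; the sign disappears in the weighted
      norm.\<close>
    define \<rho> where "\<rho> = A *v (c + xs) - b"
    have h: "?h i = (w $ i * (\<rho> $ i / (norm (row i A))\<^sup>2)) *\<^sub>R row i A" for i
      by (simp add: row_correction_def \<rho>_def inner_row)
    have "pmf p i *\<^sub>R ?h i = (\<alpha> / F) *\<^sub>R (\<rho> $ i *\<^sub>R row i A)" for i
    proof -
      have "pmf p i * (w $ i * (\<rho> $ i / (norm (row i A))\<^sup>2)) = \<alpha> / F * \<rho> $ i"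
        using pw[of i] row[of i] by (simp add: field_simps)
      then show ?thesis
        by (simp add: h)
    qed
    then have "(\<Sum>i\<in>UNIV. pmf p i *\<^sub>R ?h i) = (\<alpha> / F) *\<^sub>R (transpose A *v \<rho>)"
      by (simp add: transpose_mult_row_sum scaleR_sum_right del: transpose_matrix_vector)
    also have "\<rho> = A *v c - (b - A *v xs)"
      by (simp add: \<rho>_def algebra_simps)
    \<comment> \<open>The inconsistent part of the system drops out of the mean by the normal
      equations, which makes the mean linear in the error.\<close>
    also have "transpose A *v (A *v c - (b - A *v xs)) = transpose A *v (A *v c)"
      unfolding matrix_vector_mult_diff_distrib[of _ "A *v c"] xs_def normal_equations by simp
    also have "(\<alpha> / F) *\<^sub>R (transpose A *v (A *v c)) = \<alpha> *\<^sub>R (G *v c)"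
      by (simp add: G_def F_def scaleR_matrix_vector_assoc[symmetric] matrix_vector_mul_assoc
          del: transpose_matrix_vector)
    finally have mean: "(\<Sum>i\<in>UNIV. pmf p i *\<^sub>R ?h i) = \<alpha> *\<^sub>R (G *v c)" .
    \<comment> \<open>One factor \<open>w $ i\<close> joins \<open>pmf p i\<close> and cancels the
      row norm through \<open>pw\<close>; the other survives as the weight in the residual
      norm.\<close>
    have "pmf p i * (norm (?h i))\<^sup>2 = \<alpha> / F * (w $ i * (\<rho> $ i)\<^sup>2)" for i
    proof -
      have "pmf p i * (norm (?h i))\<^sup>2 =
          (pmf p i * w $ i) * (w $ i * (\<rho> $ i)\<^sup>2) / (norm (row i A))\<^sup>2"
        unfolding h using row[of i]
        by (simp add: power_mult_distrib power_divide power2_eq_square)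
      then show ?thesis
        unfolding pw using row[of i] by simp
    qed
    then have second: "(\<Sum>i\<in>UNIV. pmf p i * (norm (?h i))\<^sup>2) =
        \<alpha> / F * weighted_norm_sq W (b - A *v (c + xs))"
      by (simp add: W_def weighted_norm_sq_diag_matrix sum_distrib_left \<rho>_def power2_commute)
    have card: "card J = q" and J: "finite J" "J \<noteq> {}"
      using assms(11) by (auto simp: J_def lessThan_empty_iff)
    have "expectation (\<lambda>\<omega>. \<Phi> c (Y \<omega>)) =
        expectation (\<lambda>\<omega>. (norm (c - (1 / real (card J)) *\<^sub>R (\<Sum>j\<in>J. ?h (Z j \<omega>))))\<^sup>2)"
      by (simp add: \<Phi>_def Y_def card)
    also have "\<dots> = (norm (c - \<alpha> *\<^sub>R (G *v c)))\<^sup>2 - (norm (\<alpha> *\<^sub>R (G *v c)))\<^sup>2 / real q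
        + \<alpha> / F * weighted_norm_sq W (b - A *v (c + xs)) / real q"
      unfolding mean[symmetric] second[symmetric] card[symmetric]
      by (rule expectation_norm_sq_sub_average)
         (use J dist in \<open>auto simp: J_def Z_def intro: indep_vars_subset[OF ind[unfolded Z_def]]\<close>)
    \<comment> \<open>Both squared norms are quadratic forms of squares of symmetric matrices, so
      they combine into the form of \<open>?B\<close>.\<close>
    also have "(norm (c - \<alpha> *\<^sub>R (G *v c)))\<^sup>2 - (norm (\<alpha> *\<^sub>R (G *v c)))\<^sup>2 / real q = c \<bullet> (?B *v c)"
    proof -
      have G: "transpose G = G"
        by (simp add: G_def transpose_scalar matrix_transpose_mul)
      have S: "transpose (mat 1 - \<alpha> *\<^sub>R G) = mat 1 - \<alpha> *\<^sub>R G"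
        using G by (auto simp: vec_eq_iff transpose_def mat_def)
      show ?thesis
        unfolding matrix_vector_mult_diff_rdistrib inner_diff_right
          scaleR_matrix_vector_assoc[symmetric] inner_scaleR_right
          inner_symmetric_mult_self[OF S] inner_symmetric_mult_self[OF G]
        by (simp add: power_mult_distrib)
    qed
    also have "c \<bullet> (?B *v c) \<le> sigma_max ?B * (norm c)\<^sup>2"
      by (rule inner_matrix_vector_le_sigma_max)
    finally show ?thesis
      by (simp add: mult_ac)
  qed
  \<comment> \<open>The bound \<open>expect\<close> holds for every fixed \<open>c\<close>, so
    freezing the current error reduces the conditional claim to it pointwise.\<close>
  have "AE \<omega> in M. real_cond_exp M (vimage_algebra (space M) (e k) borel)
      (\<lambda>\<omega>'. \<Phi> (e k \<omega>') (Y \<omega>')) \<omega> = expectation (\<lambda>\<omega>'. \<Phi> (e k \<omega>) (Y \<omega>'))"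
    using \<Phi>_int unfolding e_X
    by (intro real_cond_exp_indep_var[where \<Phi> = \<Phi> and f = f, OF indep f \<Phi>_meas])
  then show ?thesis
  proof (rule AE_mp, intro AE_I2 impI)
    fix \<omega>
    assume "real_cond_exp M (vimage_algebra (space M) (e k) borel)
      (\<lambda>\<omega>'. \<Phi> (e k \<omega>') (Y \<omega>')) \<omega> = expectation (\<lambda>\<omega>'. \<Phi> (e k \<omega>) (Y \<omega>'))"
    with expect[of "e k \<omega>"]
    show "real_cond_exp M (vimage_algebra (space M) (e k) borel) (\<lambda>\<omega>'. (norm (e (Suc k) \<omega>'))\<^sup>2) \<omega>
      \<le> sigma_max ((mat 1 - \<alpha> *\<^sub>R G) ** (mat 1 - \<alpha> *\<^sub>R G) - (\<alpha>\<^sup>2 / real q) *\<^sub>R (G ** G))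
            * (norm (e k \<omega>))\<^sup>2
          + \<alpha> / real q * (weighted_norm_sq W (r k \<omega>) / frobenius_sq A)"
      by (simp only: e_Suc r_def F_def) (simp add: e_def xs_def)
  qed
qed

end
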